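(* Let $\mathcal{X}$ be a finite set with $|\mathcal{X}|\ge2$, let $\pi$ be a probability measure on $\mathcal{X}$ with strictly positive masses, and let $P\in\mathcal{S}(\pi)$ be ergodic. For $S\subset\mathcal{X}$, $S\neq\emptyset,\mathcal{X}$, with complement $S'$, let $$h(S)=\frac{1}{\pi(S)}\sum_{x\in S,\,y\in S'}\pi(x)P^2(x,y).$$ Let $x^*\in\operatorname*{arg\,max}_{x\in\mathcal{X}}\left(1-P^2(x,x)\right)$. Then $$U^*=\{x^*\}\in\operatorname*{arg\,max}_{S\ne\mathcal{X},\emptyset}h(S),$$ and $0<\pi(U^* )\le\frac12$.
   Context: $\mathcal{S}(\pi)$ is the set of transition matrices $P$ on $\mathcal{X}$ with $\pi P=\pi$. Ergodic means irreducible and aperiodic. $P^2$ is the matrix square of $P$, and $\pi(A)=\sum_{z\in A}\pi(z)$. *)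

theory Defs
  imports "HOL-Analysis.Analysis" "HOL-Probability.Probability"
begin

definition mass_vec :: "'a::finite pmf \<Rightarrow> real ^ 'a" where
  "mass_vec \<pi> = (\<chi> x. pmf \<pi> x)"

text \<open>The entry \<open>P(x, y)\<close> is \<open>P $ x $ y\<close>.\<close>

definition transition_matrix :: "real ^ 'a ^ 'a::finite \<Rightarrow> bool" where
  "transition_matrix P \<longleftrightarrow> (\<forall>x y. 0 \<le> P $ x $ y) \<and> (\<forall>x. (\<Sum>y\<in>UNIV. P $ x $ y) = 1)"

definition stationary_matrices :: "'a::finite pmf \<Rightarrow> (real ^ 'a ^ 'a) set" where
  "stationary_matrices \<pi> = {P. transition_matrix P \<and> mass_vec \<pi> v* P = mass_vec \<pi>}"

text \<open>On \<open>real ^ 'a ^ 'a\<close> the library operations \<open>*\<close> and \<open>^\<close> act entrywise,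
  so powers for the matrix product \<open>**\<close> are defined here.\<close>

primrec matpow :: "real ^ 'a ^ 'a::finite \<Rightarrow> nat \<Rightarrow> real ^ 'a ^ 'a" where
  "matpow P 0 = mat 1"
| "matpow P (Suc n) = matpow P n ** P"

definition irreducible_chain :: "real ^ 'a ^ 'a::finite \<Rightarrow> bool" where
  "irreducible_chain P \<longleftrightarrow> (\<forall>x y. \<exists>n. 0 < matpow P n $ x $ y)"

definition period :: "real ^ 'a ^ 'a::finite \<Rightarrow> 'a \<Rightarrow> nat" where
  "period P x = Gcd {n. 1 \<le> n \<and> 0 < matpow P n $ x $ x}"

definition aperiodic_chain :: "real ^ 'a ^ 'a::finite \<Rightarrow> bool" where
  "aperiodic_chain P \<longleftrightarrow> (\<forall>x. period P x = 1)"

definition ergodic_chain :: "real ^ 'a ^ 'a::finite \<Rightarrow> bool" where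
  "ergodic_chain P \<longleftrightarrow> irreducible_chain P \<and> aperiodic_chain P"

definition escape :: "'a::finite pmf \<Rightarrow> real ^ 'a ^ 'a \<Rightarrow> 'a set \<Rightarrow> real" where
  "escape \<pi> P S =
     1 / measure_pmf.prob \<pi> S * (\<Sum>x\<in>S. \<Sum>y\<in>- S. pmf \<pi> x * (P ** P) $ x $ y)"

end

theory Submission
  imports Defs
begin

text \<open>Write \<open>Q = P\<^sup>2\<close>. For \<open>x \<in> S\<close> one has \<open>Q(x, S') \<le> 1 - Q(x, x)\<close>, so \<open>h(S)\<close> is at most a
  \<open>\<pi>\<close>-average over \<open>S\<close> of the numbers \<open>1 - Q(x, x)\<close>, hence at most \<open>m = 1 - Q(x\<^sup>*, x\<^sup>*) = h({x\<^sup>*})\<close>.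
  By stationarity the flow \<open>\<pi>(x\<^sup>*) m\<close> out of \<open>x\<^sup>*\<close> equals the flow
  \<open>\<Sum>y\<noteq>x\<^sup>*. \<pi>(y) Q(y, x\<^sup>*) \<le> (1 - \<pi>(x\<^sup>*)) m\<close> into it, which gives \<open>\<pi>(x\<^sup>*) \<le> 1/2\<close> as soon as \<open>m > 0\<close>.
  If \<open>m = 0\<close> then \<open>P\<^sup>2\<close> is the identity, and then aperiodicity forces \<open>P\<close> itself to be the identity,
  which is not irreducible on two or more states.\<close>

lemma transition_matrix_mult:
  assumes "transition_matrix P" "transition_matrix Q"
  shows "transition_matrix (P ** Q)"
  unfolding transition_matrix_def
proof (intro conjI allI)
  show "0 \<le> (P ** Q) $ x $ y" for x y
    using assms by (auto simp: matrix_matrix_mult_def transition_matrix_def intro!: sum_nonneg)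
  show "(\<Sum>y\<in>UNIV. (P ** Q) $ x $ y) = 1" for x
  proof -
    have "(\<Sum>y\<in>UNIV. (P ** Q) $ x $ y) = (\<Sum>y\<in>UNIV. \<Sum>k\<in>UNIV. P $ x $ k * Q $ k $ y)"
      by (simp add: matrix_matrix_mult_def)
    also have "\<dots> = (\<Sum>k\<in>UNIV. P $ x $ k * (\<Sum>y\<in>UNIV. Q $ k $ y))"
      by (subst sum.swap) (simp add: sum_distrib_left)
    also have "\<dots> = 1"
      using assms by (simp add: transition_matrix_def)
    finally show ?thesis .
  qed
qed

lemma stationary_matrices_mult:
  assumes "P \<in> stationary_matrices \<pi>" "Q \<in> stationary_matrices \<pi>"
  shows "P ** Q \<in> stationary_matrices \<pi>"
  using assms transition_matrix_mult
  by (auto simp: stationary_matrices_def simp flip: vector_matrix_mul_assoc)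

lemma stationary_matrices_sum:
  assumes "Q \<in> stationary_matrices \<pi>"
  shows "(\<Sum>y\<in>UNIV. pmf \<pi> y * Q $ y $ x) = pmf \<pi> x"
proof -
  have "(mass_vec \<pi> v* Q) $ x = mass_vec \<pi> $ x"
    using assms by (simp add: stationary_matrices_def)
  then show ?thesis
    by (simp add: mass_vec_def vector_matrix_mult_def mult.commute)
qed

lemma transition_matrix_sum_Compl:
  assumes "transition_matrix Q"
  shows "(\<Sum>y\<in>- {x}. Q $ x $ y) = 1 - Q $ x $ x"
proof -
  have "(\<Sum>y\<in>UNIV. Q $ x $ y) = Q $ x $ x + (\<Sum>y\<in>- {x}. Q $ x $ y)"
    by (simp add: sum.remove Compl_eq_Diff_UNIV)
  then show ?thesis
    using assms by (simp add: transition_matrix_def)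
qed

text \<open>The entry is one of the nonnegative terms of the off-diagonal row sum. The bound serves
  both to make rows vanish and to control the flow into a state.\<close>

lemma transition_matrix_entry_le:
  assumes "transition_matrix Q" "x \<noteq> y"
  shows "Q $ x $ y \<le> 1 - Q $ x $ x"
  unfolding transition_matrix_sum_Compl[OF assms(1), symmetric]
  by (rule member_le_sum) (use assms in \<open>auto simp: transition_matrix_def\<close>)

lemma transition_matrix_eq_mat_1:
  assumes "transition_matrix Q" "\<And>x. 1 - Q $ x $ x \<le> 0"
  shows "Q = mat 1"
proof -
  have off: "Q $ x $ y = 0" if "x \<noteq> y" for x y
    using transition_matrix_entry_le[OF assms(1) that] assms(2)[of x] assms(1)
    by (auto simp: transition_matrix_def intro: antisym order_trans)
  have "Q $ x $ x = 1" for x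
    using transition_matrix_sum_Compl[OF assms(1), of x] off by simp
  with off show ?thesis
    by (auto simp: vec_eq_iff mat_def)
qed

lemma measure_pmf_finite_type:
  "measure_pmf.prob (\<pi> :: 'a::finite pmf) S = sum (pmf \<pi>) S"
  by (simp add: measure_measure_pmf_finite)

lemma escape_le:
  assumes "\<forall>x. 0 < pmf \<pi> x" "transition_matrix (P ** P)" "S \<noteq> {}"
    and m: "\<And>x. 1 - (P ** P) $ x $ x \<le> m"
  shows "escape \<pi> P S \<le> m"
proof -
  let ?Q = "P ** P"
  have pos: "0 < sum (pmf \<pi>) S"
    using assms by (intro sum_pos) auto
  have "(\<Sum>x\<in>S. \<Sum>y\<in>- S. pmf \<pi> x * ?Q $ x $ y) \<le> (\<Sum>x\<in>S. pmf \<pi> x * m)"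
  proof (rule sum_mono)
    fix x assume "x \<in> S"
    \<comment> \<open>Since \<open>x \<in> S\<close>, the set \<open>- S\<close> lies in
      \<open>- {x}\<close>, and the extra entries are nonnegative.\<close>
    then have "(\<Sum>y\<in>- S. ?Q $ x $ y) \<le> (\<Sum>y\<in>- {x}. ?Q $ x $ y)"
      using assms(2) by (intro sum_mono2) (auto simp: transition_matrix_def)
    also have "\<dots> \<le> m"
      using m transition_matrix_sum_Compl[OF assms(2)] by simp
    finally show "(\<Sum>y\<in>- S. pmf \<pi> x * ?Q $ x $ y) \<le> pmf \<pi> x * m"
      by (simp add: mult_left_mono flip: sum_distrib_left)
  qed
  also have "\<dots> = m * sum (pmf \<pi>) S"
    by (simp add: sum_distrib_left mult.commute)
  finally show ?thesis
    using pos by (simp add: escape_def measure_pmf_finite_type divide_le_eq)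
qed

lemma escape_singleton:
  assumes "0 < pmf \<pi> x" "transition_matrix (P ** P)"
  shows "escape \<pi> P {x} = 1 - (P ** P) $ x $ x"
  using assms transition_matrix_sum_Compl[OF assms(2), of x]
  by (simp add: escape_def measure_pmf_finite_type flip: sum_distrib_left)

lemma stationary_mass_le_half:
  assumes "Q \<in> stationary_matrices \<pi>"
    and pos: "0 < 1 - Q $ x $ x" and m: "\<And>y. 1 - Q $ y $ y \<le> 1 - Q $ x $ x"
  shows "pmf \<pi> x \<le> 1 / 2"
proof -
  let ?m = "1 - Q $ x $ x"
  have tr: "transition_matrix Q"
    using assms(1) by (simp add: stationary_matrices_def)
  have total: "pmf \<pi> x + (\<Sum>y\<in>- {x}. pmf \<pi> y) = 1"
    using sum_pmf_eq_1[of UNIV \<pi>]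
    by (simp add: sum.remove[of UNIV x] Compl_eq_Diff_UNIV)
  have "pmf \<pi> x * Q $ x $ x + (\<Sum>y\<in>- {x}. pmf \<pi> y * Q $ y $ x) = pmf \<pi> x"
    using stationary_matrices_sum[OF assms(1), of x]
    by (simp add: sum.remove[of UNIV x] Compl_eq_Diff_UNIV)
  then have "pmf \<pi> x * ?m = (\<Sum>y\<in>- {x}. pmf \<pi> y * Q $ y $ x)"
    by (simp add: algebra_simps)
  \<comment> \<open>The entry in column \<open>x\<close> is bounded through its own row
    \<open>y\<close>, by \<open>1 - Q $ y $ y\<close>, and then by maximality at
    \<open>x\<close>.\<close>
  also have "\<dots> \<le> (\<Sum>y\<in>- {x}. pmf \<pi> y * ?m)"
    by (intro sum_mono mult_left_mono order_trans[OF transition_matrix_entry_le[OF tr] m]) auto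
  also have "\<dots> = (1 - pmf \<pi> x) * ?m"
    using total by (simp flip: sum_distrib_right)
  finally show ?thesis
    using pos by (simp add: mult_le_cancel_right)
qed

lemma matpow_involution:
  assumes "P ** P = mat 1"
  shows "matpow P n = (if even n then mat 1 else P)"
  by (induction n) (auto simp: assms)

text \<open>If the square is the identity, every power is \<open>mat 1\<close> or \<open>P\<close>.
  Aperiodicity makes the diagonal of \<open>P\<close> positive, which forces the off-diagonal
  entries to vanish, so no two distinct states communicate.\<close>

lemma ergodic_chain_square_neq_mat_1:
  fixes P :: "real ^ 'a ^ 'a::finite"
  assumes "CARD('a) \<ge> 2" "transition_matrix P" "ergodic_chain P"
  shows "P ** P \<noteq> mat 1"
proof
  assume sq: "P ** P = mat 1"
  have diag: "0 < P $ x $ x" for x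
  proof (rule ccontr)
    assume "\<not> 0 < P $ x $ x"
    \<comment> \<open>Odd powers equal \<open>P\<close>, whose entry at \<open>x\<close> is not
      positive, so every return time is even.\<close>
    then have "2 dvd period P x"
      unfolding period_def by (intro Gcd_greatest) (auto simp: matpow_involution[OF sq] split: if_splits)
    moreover have "period P x = 1"
      using assms(3) by (simp add: ergodic_chain_def aperiodic_chain_def)
    ultimately show False
      by simp
  qed
  have off: "P $ x $ y = 0" if "x \<noteq> y" for x y
  proof -
    \<comment> \<open>Only the two-step path that first stays at \<open>x\<close> is kept; its
      weight is at most an off-diagonal entry of the identity.\<close>
    have "P $ x $ x * P $ x $ y \<le> (\<Sum>k\<in>UNIV. P $ x $ k * P $ k $ y)"
      using assms(2) by (intro member_le_sum) (auto simp: transition_matrix_def)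
    also have "\<dots> = (P ** P) $ x $ y"
      by (simp add: matrix_matrix_mult_def)
    also have "\<dots> = 0"
      using that by (simp add: sq mat_def)
    finally show ?thesis
      using diag[of x] assms(2) by (auto simp: transition_matrix_def mult_le_0_iff intro: antisym)
  qed
  obtain x y :: 'a where "x \<noteq> y"
    using assms(1) by (metis One_nat_def UNIV_I card_le_Suc0_iff_eq finite not_less_eq_eq numeral_2_eq_2)
  moreover obtain n where "0 < matpow P n $ x $ y"
    using assms(3) by (auto simp: ergodic_chain_def irreducible_chain_def)
  ultimately show False
    using off by (auto simp: matpow_involution[OF sq] mat_def split: if_splits)
qed

theorem proposition4p8:
  fixes \<pi> :: "'a::finite pmf" and P :: "real ^ 'a ^ 'a" and x_star :: 'a
  assumes "CARD('a) \<ge> 2"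
    and "\<forall>x. 0 < pmf \<pi> x"
    and "P \<in> stationary_matrices \<pi>"
    and "ergodic_chain P"
    and "is_arg_max (\<lambda>x. 1 - (P ** P) $ x $ x) (\<lambda>_. True) x_star"
  shows "is_arg_max (escape \<pi> P) (\<lambda>S. S \<noteq> UNIV \<and> S \<noteq> {}) {x_star}
    \<and> 0 < measure_pmf.prob \<pi> {x_star}
    \<and> measure_pmf.prob \<pi> {x_star} \<le> 1 / 2"
proof -
  let ?Q = "P ** P"
  let ?m = "1 - ?Q $ x_star $ x_star"
  have Q: "?Q \<in> stationary_matrices \<pi>"
    using assms(3) by (rule stationary_matrices_mult[OF _ assms(3)])
  then have tr: "transition_matrix ?Q"
    by (simp add: stationary_matrices_def)
  have m: "1 - ?Q $ x $ x \<le> ?m" for x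
    using assms(5) by (auto simp: is_arg_max_def not_less)
  have "0 < ?m"
  proof (rule ccontr)
    assume "\<not> 0 < ?m"
    then have "?Q = mat 1"
      using m by (intro transition_matrix_eq_mat_1[OF tr]) (meson not_less order_trans)
    then show False
      using ergodic_chain_square_neq_mat_1[of P] assms by (simp add: stationary_matrices_def)
  qed
  then have half: "pmf \<pi> x_star \<le> 1 / 2"
    using stationary_mass_le_half[OF Q] m by blast
  have "{x_star} \<noteq> UNIV"
    using assms(1) by (auto dest: arg_cong[where f = card])
  \<comment> \<open>The singleton attains the upper bound \<open>?m\<close> valid for all nonempty
    \<open>S\<close>.\<close>
  then have "is_arg_max (escape \<pi> P) (\<lambda>S. S \<noteq> UNIV \<and> S \<noteq> {}) {x_star}"
    using escape_le[OF assms(2) tr _ m] escape_singleton[OF _ tr, of \<pi> x_star] assms(2)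
    by (auto simp: is_arg_max_def not_less)
  with half assms(2) show ?thesis
    by (simp add: measure_pmf_finite_type)
qed

end
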